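(* Consider a setting with $\Lambda$ caches and $K=\Lambda B$ users, with $\Lambda$ and $\gamma$ fixed and $G=|\mathcal G|=\Lambda\gamma+1$. For any average SNR $\rho>0$, $$\lim_{B\to\infty}\frac{\bar R^{(\mathrm{ACC})}}{\bar R^{(\mathrm{MN})}}=\exp\left(\frac{1-G}{\rho}\right)\frac{\mathrm{Ei}\left(-\frac1\rho\right)}{\mathrm{Ei}\left(-\frac{G}{\rho}\right)} .$$ Furthermore, $$\lim_{\rho\to0^+}\ \lim_{B\to\infty}\ \frac{\bar R^{(\mathrm{ACC})}}{\bar R^{(\mathrm{MN})}}=\Lambda\gamma+1 .$$
   Context: Setting: $K=\Lambda B$ users are divided into $\Lambda$ groups of $B$ users each (users in a group share the same cache content). $\gamma\in[0,1]$ is the normalized cache size, $\Lambda\gamma$ is an integer with $\Lambda\gamma+1\le\Lambda$, and $\mathcal G\subseteq\{1,\dots,\Lambda\}$ has $G=|\mathcal G|=\Lambda\gamma+1$ elements. All instantaneous SNRs ($\mathrm{SNR}_{g,b}$ for user $b$ of group $g$, or $\mathrm{SNR}_k$ for user $k$) are i.i.d. exponential random variables with mean $\rho>0$ (density $\frac1\rho e^{-x/\rho}$, $x\ge0$). The average rate of the ACC (Aggregated Coded Caching) scheme is $$\bar R^{(\mathrm{ACC})}=\frac{G}{\ln2}\,\mathbb E\Big\{\min_{g\in\mathcal G}\frac1B\sum_{b=1}^B\ln(1+\mathrm{SNR}_{g,b})\Big\}.$$ The average rate of the MN scheme, which multicasts to a set of $G$ users (also denoted $\mathcal G$) at a time,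 is $$\bar R^{(\mathrm{MN})}=\frac{G}{\ln 2}\,\mathbb E\Big\{\ln\big(1+\min_{k\in\mathcal G}\mathrm{SNR}_k\big)\Big\}.$$ Notation: $\mathrm{Ei}$ is the exponential integral function; for $x>0$, $\mathrm{Ei}(-x)=-\int_x^\infty\frac{e^{-u}}{u}\,\mathrm du$. *)

theory Defs
  imports "HOL-Probability.Probability"
begin

(* The mean of the density exponential_density l is 1 / l, hence the parameter 1 / \<rho>. *)
definition iid_exponential ::
    "'a measure \<Rightarrow> real \<Rightarrow> 'u set \<Rightarrow> ('u \<Rightarrow> 'a \<Rightarrow> real) \<Rightarrow> bool" where
  "iid_exponential M \<rho> I X \<longleftrightarrow>
     prob_space M \<and>
     prob_space.indep_vars M (\<lambda>_. borel) X I \<and>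
     (\<forall>i\<in>I. distributed M lborel (X i) (exponential_density (1 / \<rho>)))"

(* A user is a pair (g, b): user b of group g. *)
definition users :: "nat \<Rightarrow> nat \<Rightarrow> (nat \<times> nat) set" where
  "users \<Lambda> B = {1..\<Lambda>} \<times> {1..B}"

(* S is the set of served groups. *)
definition rate_ACC ::
    "'a measure \<Rightarrow> nat \<Rightarrow> nat set \<Rightarrow> (nat \<times> nat \<Rightarrow> 'a \<Rightarrow> real) \<Rightarrow> real" where
  "rate_ACC M B S SNR =
     real (card S) / ln 2 *
     prob_space.expectation M
       (\<lambda>\<omega>. MIN g\<in>S. 1 / real B * (\<Sum>b = 1..B. ln (1 + SNR (g, b) \<omega>)))"

(* U is the set of served users. *)
definition rate_MN ::
    "'a measure \<Rightarrow> (nat \<times> nat) set \<Rightarrow> (nat \<times> nat \<Rightarrow> 'a \<Rightarrow> real) \<Rightarrow> real" where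
  "rate_MN M U SNR =
     real (card U) / ln 2 *
     prob_space.expectation M (\<lambda>\<omega>. ln (1 + (MIN k\<in>U. SNR k \<omega>)))"

(* This is the exponential integral only for y < 0; for y > 0 the function Ei is a
   principal value, which is not covered here. *)
definition Ei :: "real \<Rightarrow> real" where
  "Ei y = - (LBINT u:{-y..}. exp (- u) / u)"

end

theory Submission
  imports Defs "HOL-Real_Asymp.Real_Asymp"
begin

text \<open>
  Write \<open>f l = - exp l * Ei (- l)\<close>. Integration by parts identifies \<open>f l\<close> with the expectation of
  \<open>ln (1 + X)\<close> for \<open>X\<close> exponential of rate \<open>l\<close>. The minimum of \<open>G\<close> such variables of rate
  \<open>1 / \<rho>\<close> is exponential of rate \<open>G / \<rho>\<close>, so the MN rate is \<open>G / ln 2 * f (G / \<rho>)\<close> for every \<open>B\<close>.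
  In the ACC rate each group average concentrates around \<open>f (1 / \<rho>)\<close> with \<open>L\<^sup>1\<close> error of order
  \<open>1 / sqrt B\<close>, and the error of the minimum is at most the sum of the errors of the \<open>G\<close> averages.
  This bound involves only the distribution of the variables, so the probability space may change
  with \<open>B\<close>. For the limit \<open>\<rho> \<rightarrow> 0\<close>, the estimate
  \<open>exp (- x) \<le> 1 / (1 + x) \<le> 1\<close> gives \<open>1 / (l + 1) \<le> f l \<le> 1 / l\<close>.
\<close>

section \<open>Integrals of exponentials over the positive half-line, and \<open>Ei\<close>\<close>

lemma has_bochner_integral_erlang_ith_moment:
  fixes l :: real assumes "0 < l"
  shows "has_bochner_integral lborel (\<lambda>x. erlang_density k l x * x ^ i) (fact (k + i) / (fact k * l ^ i))"
proof (rule has_bochner_integral_nn_integral)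
  show "AE x in lborel. 0 \<le> erlang_density k l x * x ^ i"
    using assms by (auto simp: erlang_density_def)
  show "(\<integral>\<^sup>+ x. ennreal (erlang_density k l x * x ^ i) \<partial>lborel) = ennreal (fact (k + i) / (fact k * l ^ i))"
    using nn_integral_erlang_ith_moment[OF assms] .
qed (use assms in auto)

text \<open>This is the zeroth moment of the exponential density divided by \<open>l\<close>. The
  half-line is open so as to agree with \<open>einterval 0 \<infinity>\<close> in the later
  integration by parts; the point 0 is a null set.\<close>

lemma has_bochner_integral_exp_pos:
  fixes l :: real assumes "0 < l"
  shows "has_bochner_integral lborel (\<lambda>x. indicator {0<..} x * exp (- l * x)) (1 / l)"
proof -
  have "has_bochner_integral lborel (\<lambda>x. erlang_density 0 l x * x ^ 0 / l) (1 / l)"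
    using has_bochner_integral_divide_zero[OF has_bochner_integral_erlang_ith_moment[OF assms, of 0 0]] by simp
  moreover have "AE x in lborel. erlang_density 0 l x * x ^ 0 / l = indicator {0<..} x * exp (- l * x)"
    using AE_lborel_singleton[of 0]
    by eventually_elim (use assms in \<open>auto simp: erlang_density_def split: split_indicator\<close>)
  ultimately show ?thesis
    by (subst (asm) has_bochner_integral_cong_AE) auto
qed

lemma integrable_exp_div:
  fixes l :: real assumes "0 < l"
  shows "integrable lborel (\<lambda>x. indicator {0<..} x * (exp (- l * x) / (1 + x)))"
  by (rule Bochner_Integration.integrable_bound[OF integrable.intros[OF has_bochner_integral_exp_pos[OF assms]]])
    (auto split: split_indicator simp: field_simps)

lemma integral_exp_div_le:
  fixes l :: real assumes "0 < l"
  shows "(\<integral>x. indicator {0<..} x * (exp (- l * x) / (1 + x)) \<partial>lborel) \<le> 1 / l"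
proof -
  have "(\<integral>x. indicator {0<..} x * (exp (- l * x) / (1 + x)) \<partial>lborel)
      \<le> (\<integral>x. indicator {0<..} x * exp (- l * x) \<partial>lborel)"
    by (intro integral_mono integrable_exp_div integrable.intros[OF has_bochner_integral_exp_pos] assms)
      (auto split: split_indicator simp: field_simps)
  then show ?thesis
    using has_bochner_integral_integral_eq[OF has_bochner_integral_exp_pos[OF assms]] by simp
qed

text \<open>Since \<open>1 + x \<le> exp x\<close>, the integrand dominates
  \<open>exp (- (l + 1) * x)\<close>, whose integral over the half-line is
  \<open>1 / (l + 1)\<close>.\<close>

lemma integral_exp_div_ge:
  fixes l :: real assumes "0 < l"
  shows "1 / (l + 1) \<le> (\<integral>x. indicator {0<..} x * (exp (- l * x) / (1 + x)) \<partial>lborel)"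
proof -
  have l1: "0 < l + 1" using assms by simp
  have *: "exp (- (l + 1) * x) \<le> exp (- l * x) / (1 + x)" if "x > 0" for x :: real
  proof -
    have "exp (- (l + 1) * x) = exp (- l * x) / exp x"
      by (simp add: exp_diff[symmetric] algebra_simps)
    also have "\<dots> \<le> exp (- l * x) / (1 + x)"
      using that exp_ge_add_one_self[of x] by (intro divide_left_mono) auto
    finally show ?thesis .
  qed
  have "(\<integral>x. indicator {0<..} x * exp (- (l + 1) * x) \<partial>lborel)
      \<le> (\<integral>x. indicator {0<..} x * (exp (- l * x) / (1 + x)) \<partial>lborel)"
    by (intro integral_mono integrable_exp_div integrable.intros[OF has_bochner_integral_exp_pos] assms l1)
      (use * in \<open>auto split: split_indicator\<close>)
  then show ?thesis
    using has_bochner_integral_integral_eq[OF has_bochner_integral_exp_pos[OF l1]] by simp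
qed

text \<open>Substitution \<open>u = l * (1 + x)\<close>.\<close>
lemma Ei_neg_eq:
  fixes l :: real assumes "0 < l"
  shows "- exp l * Ei (- l) = (\<integral>x. indicator {0<..} x * (exp (- l * x) / (1 + x)) \<partial>lborel)"
proof -
  have "- Ei (- l) = (\<integral>u. indicator {l..} u * (exp (- u) / u) \<partial>lborel)"
    by (simp add: Ei_def set_lebesgue_integral_def)
  also have "\<dots> = l * (\<integral>x. indicator {l..} (l + l * x) * (exp (- (l + l * x)) / (l + l * x)) \<partial>lborel)"
    using assms by (subst lborel_integral_real_affine[where c = l and t = l]) auto
  also have "(\<integral>x. indicator {l..} (l + l * x) * (exp (- (l + l * x)) / (l + l * x)) \<partial>lborel)
     = (\<integral>x. exp (- l) / l * (indicator {0<..} x * (exp (- l * x) / (1 + x))) \<partial>lborel)"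
  proof (rule integral_cong_AE)
    show "AE x in lborel. indicator {l..} (l + l * x) * (exp (- (l + l * x)) / (l + l * x)) =
        exp (- l) / l * (indicator {0<..} x * (exp (- l * x) / (1 + x)))"
      \<comment> \<open>The indicator of \<open>{l..}\<close> pulls back to that of
        \<open>{0..}\<close>, which differs from the one of \<open>{0<..}\<close> only at 0.\<close>
      using AE_lborel_singleton[of 0]
    proof eventually_elim
      case (elim x)
      have "l + l * x = l * (1 + x)" "exp (- (l + l * x)) = exp (- l) * exp (- l * x)"
        by (simp_all add: algebra_simps exp_add[symmetric])
      moreover have "l \<le> l + l * x \<longleftrightarrow> 0 < x"
        using assms elim by (auto simp: zero_le_mult_iff)
      ultimately show ?case
        by (auto split: split_indicator)
    qed
  qed auto
  also have "l * \<dots> = exp (- l) * (\<integral>x. indicator {0<..} x * (exp (- l * x) / (1 + x)) \<partial>lborel)"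
    using assms by (subst integral_mult_right_zero) simp
  finally show ?thesis
    by (simp add: exp_minus field_simps)
qed

section \<open>Expected logarithm under the exponential density\<close>

lemma integrable_exponential_density_moment:
  assumes "0 < l"
  shows "integrable lborel (\<lambda>x. exponential_density l x * x ^ i)"
  using has_bochner_integral_erlang_ith_moment[OF assms] by (rule integrable.intros)

text \<open>On the support, \<open>0 \<le> ln (1 + x) \<le> x\<close>, so the moments of the density
  dominate. Power 1 serves for means and power 2 for variances.\<close>

lemma integrable_exponential_density_ln_power:
  assumes "0 < l"
  shows "integrable lborel (\<lambda>x. exponential_density l x * ln (1 + x) ^ i)"
proof (rule Bochner_Integration.integrable_bound[OF integrable_exponential_density_moment[OF assms, of i]])
  show "AE x in lborel. norm (exponential_density l x * ln (1 + x) ^ i) \<le> norm (exponential_density l x * x ^ i)"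
  proof (intro AE_I2)
    fix x :: real
    have "ln (1 + x) ^ i \<le> x ^ i" if "0 \<le> x"
      using that by (intro power_mono ln_add_one_self_le_self ln_ge_zero) auto
    then show "norm (exponential_density l x * ln (1 + x) ^ i) \<le> norm (exponential_density l x * x ^ i)"
      using assms by (auto simp: exponential_density_def abs_mult)
  qed
qed auto

text \<open>Integration by parts: \<open>?a - ?b\<close> is the derivative of
  \<open>- exp (- l * x) * ln (1 + x)\<close>, which tends to 0 at both ends. Hence
  \<open>?a\<close> and \<open>?b\<close> have the same integral, and that of \<open>?b\<close> is
  already expressed by \<open>Ei\<close>.\<close>

lemma integral_exponential_density_ln:
  assumes l: "0 < l"
  shows "(\<integral>x. exponential_density l x * ln (1 + x) \<partial>lborel) = - exp l * Ei (- l)"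
proof -
  let ?a = "\<lambda>x. l * exp (- l * x) * ln (1 + x)" and ?b = "\<lambda>x. exp (- l * x) / (1 + x)"
  \<comment> \<open>The equality holds at \<open>x = 0\<close> too, because
    \<open>ln (1 + x)\<close> vanishes there.\<close>
  have eqa: "indicator {0<..} x * ?a x = exponential_density l x * ln (1 + x)" for x :: real
    by (auto simp: exponential_density_def mult.commute split: split_indicator)
  have ia: "integrable lborel (\<lambda>x. indicator {0<..} x * ?a x)"
    unfolding eqa using integrable_exponential_density_ln_power[OF l, of 1] by simp
  note ib = integrable_exp_div[OF l]
  have "(LBINT x=0..\<infinity>. ?a x - ?b x) = 0 - 0"
  proof (rule interval_integral_FTC_integrable)
    show "((\<lambda>x. - exp (- l * x) * ln (1 + x)) has_vector_derivative ?a x - ?b x) (at x)"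
      if "0 < ereal x" "ereal x < \<infinity>" for x
      using that unfolding has_real_derivative_iff_has_vector_derivative[symmetric]
      by (auto intro!: derivative_eq_intros simp: field_simps)
    show "isCont (\<lambda>x. ?a x - ?b x) x" if "0 < ereal x" "ereal x < \<infinity>" for x
      using that by (auto intro!: continuous_intros)
    show "set_integrable lborel (einterval 0 \<infinity>) (\<lambda>x. ?a x - ?b x)"
      using Bochner_Integration.integrable_diff[OF ia ib]
      by (simp add: set_integrable_def zero_ereal_def right_diff_distrib)
    have "((\<lambda>x. - exp (- l * x) * ln (1 + x)) \<longlongrightarrow> - exp (- l * 0) * ln (1 + 0)) (at_right 0)"
      by (intro tendsto_intros) auto
    then show "(((\<lambda>x. - exp (- l * x) * ln (1 + x)) \<circ> real_of_ereal) \<longlongrightarrow> 0) (at_right 0)"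
      by (simp add: zero_ereal_def ereal_tendsto_simps)
    show "(((\<lambda>x. - exp (- l * x) * ln (1 + x)) \<circ> real_of_ereal) \<longlongrightarrow> 0) (at_left \<infinity>)"
      unfolding ereal_tendsto_simps using l by real_asymp
  qed auto
  then have "(\<integral>x. indicator {0<..} x * ?a x - indicator {0<..} x * ?b x \<partial>lborel) = 0"
    by (simp add: interval_lebesgue_integral_0_infty set_lebesgue_integral_def right_diff_distrib)
  then have "(\<integral>x. indicator {0<..} x * ?a x \<partial>lborel) = (\<integral>x. indicator {0<..} x * ?b x \<partial>lborel)"
    using Bochner_Integration.integral_diff[OF ia ib] by simp
  then show ?thesis
    unfolding eqa Ei_neg_eq[OF l] .
qed

text \<open>Besides the asymptotics for large \<open>l\<close>, the lower bound yields
  \<open>Ei (- l) \<noteq> 0\<close>, which keeps the quotient of the rates meaningful.\<close>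

lemma neg_exp_Ei_bounds:
  assumes "0 < l"
  shows "1 / (l + 1) \<le> - exp l * Ei (- l)" "- exp l * Ei (- l) \<le> 1 / l"
  using integral_exp_div_ge[OF assms] integral_exp_div_le[OF assms] Ei_neg_eq[OF assms] by simp_all

lemma tendsto_neg_exp_Ei:
  "((\<lambda>l. l * (- exp l * Ei (- l))) \<longlongrightarrow> 1) at_top"
proof (rule tendsto_sandwich)
  show "((\<lambda>l::real. l / (l + 1)) \<longlongrightarrow> 1) at_top" "((\<lambda>_. 1) \<longlongrightarrow> (1::real)) at_top"
    by (real_asymp, simp)
  show "\<forall>\<^sub>F l in at_top. l / (l + 1) \<le> l * (- exp l * Ei (- l))"
    using eventually_gt_at_top[of 0]
  proof eventually_elim
    case (elim l)
    then show ?case using mult_left_mono[OF neg_exp_Ei_bounds(1)[OF elim], of l] by simp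
  qed
  show "\<forall>\<^sub>F l in at_top. l * (- exp l * Ei (- l)) \<le> 1"
    using eventually_gt_at_top[of 0]
  proof eventually_elim
    case (elim l)
    then show ?case using mult_left_mono[OF neg_exp_Ei_bounds(2)[OF elim], of l] by simp
  qed
qed

section \<open>Second moments and an \<open>L\<^sup>1\<close> law of large numbers\<close>

text \<open>Each new summand is independent of the partial sum and centred, so the cross term has
  expectation 0. Integrability is part of the claim because the induction step needs it to split the
  expectation.\<close>

lemma (in prob_space) second_moment_sum_indep:
  fixes Z :: "'i \<Rightarrow> 'a \<Rightarrow> real"
  assumes "finite I" "indep_vars (\<lambda>_. borel) Z I"
    and "\<And>i. i \<in> I \<Longrightarrow> integrable M (Z i)" "\<And>i. i \<in> I \<Longrightarrow> integrable M (\<lambda>\<omega>. (Z i \<omega>)\<^sup>2)"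
    and "\<And>i. i \<in> I \<Longrightarrow> expectation (Z i) = 0"
  shows "integrable M (\<lambda>\<omega>. (\<Sum>i\<in>I. Z i \<omega>)\<^sup>2) \<and>
    expectation (\<lambda>\<omega>. (\<Sum>i\<in>I. Z i \<omega>)\<^sup>2) = (\<Sum>i\<in>I. expectation (\<lambda>\<omega>. (Z i \<omega>)\<^sup>2))"
  using assms
proof (induction I)
  case (insert i I)
  let ?S = "\<lambda>\<omega>. \<Sum>i\<in>I. Z i \<omega>"
  have IH: "integrable M (\<lambda>\<omega>. (?S \<omega>)\<^sup>2)"
    "expectation (\<lambda>\<omega>. (?S \<omega>)\<^sup>2) = (\<Sum>i\<in>I. expectation (\<lambda>\<omega>. (Z i \<omega>)\<^sup>2))"
    using insert indep_vars_subset[OF insert.prems(1), of I] by auto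
  have ind: "indep_var borel (Z i) borel ?S"
    using insert by (intro indep_vars_sum) auto
  have intS: "integrable M ?S" and intZ: "integrable M (Z i)"
    using insert by auto
  have cross: "integrable M (\<lambda>\<omega>. Z i \<omega> * ?S \<omega>)" "expectation (\<lambda>\<omega>. Z i \<omega> * ?S \<omega>) = 0"
    using indep_var_integrable[OF ind intZ intS] indep_var_lebesgue_integral[OF ind intZ intS] insert
    by auto
  have eq: "(\<Sum>i\<in>insert i I. Z i \<omega>)\<^sup>2 = (Z i \<omega>)\<^sup>2 + 2 * (Z i \<omega> * ?S \<omega>) + (?S \<omega>)\<^sup>2" for \<omega>
    using insert by (simp add: power2_sum)
  show ?case
    unfolding eq using insert IH cross by simp
qed simp

text \<open>This expresses that the variance of \<open>\<bar>X\<bar>\<close> is nonnegative.\<close>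

lemma (in prob_space) L1_le_sqrt_second_moment:
  fixes X :: "'a \<Rightarrow> real"
  assumes "integrable M X" "integrable M (\<lambda>\<omega>. (X \<omega>)\<^sup>2)"
  shows "expectation (\<lambda>\<omega>. \<bar>X \<omega>\<bar>) \<le> sqrt (expectation (\<lambda>\<omega>. (X \<omega>)\<^sup>2))"
  using variance_eq[of "\<lambda>\<omega>. \<bar>X \<omega>\<bar>"] variance_positive[of "\<lambda>\<omega>. \<bar>X \<omega>\<bar>"] assms
  by (intro real_le_rsqrt) simp

text \<open>The centred sum has second moment \<open>card I * v\<close>; scaling by
  \<open>1 / card I\<close> leaves \<open>v / card I\<close>, and the second moment controls the
  \<open>L\<^sup>1\<close> norm.\<close>

lemma (in prob_space) L1_distance_average_indep:
  fixes Y :: "'i \<Rightarrow> 'a \<Rightarrow> real"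
  assumes I: "finite I" "I \<noteq> {}" and ind: "indep_vars (\<lambda>_. borel) Y I"
    and int: "\<And>i. i \<in> I \<Longrightarrow> integrable M (Y i)" "\<And>i. i \<in> I \<Longrightarrow> integrable M (\<lambda>\<omega>. (Y i \<omega>)\<^sup>2)"
    and mean: "\<And>i. i \<in> I \<Longrightarrow> expectation (Y i) = m"
    and var: "\<And>i. i \<in> I \<Longrightarrow> variance (Y i) = v"
  shows "expectation (\<lambda>\<omega>. \<bar>1 / real (card I) * (\<Sum>i\<in>I. Y i \<omega>) - m\<bar>) \<le> sqrt (v / real (card I))"
proof -
  let ?n = "real (card I)" and ?Z = "\<lambda>i \<omega>. Y i \<omega> - m"
  have n: "?n > 0" using I by (simp add: card_gt_0_iff)
  have eq: "1 / ?n * (\<Sum>i\<in>I. Y i \<omega>) - m = 1 / ?n * (\<Sum>i\<in>I. ?Z i \<omega>)" for \<omega>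
    using n by (simp add: sum_subtractf field_simps)
  have sm: "integrable M (\<lambda>\<omega>. (\<Sum>i\<in>I. ?Z i \<omega>)\<^sup>2) \<and>
      expectation (\<lambda>\<omega>. (\<Sum>i\<in>I. ?Z i \<omega>)\<^sup>2) = (\<Sum>i\<in>I. expectation (\<lambda>\<omega>. (?Z i \<omega>)\<^sup>2))"
  proof (rule second_moment_sum_indep)
    show "indep_vars (\<lambda>_. borel) ?Z I"
      using indep_vars_compose2[OF ind, of "\<lambda>_ y. y - m"] by auto
    show "expectation (?Z i) = 0" "integrable M (?Z i)" if "i \<in> I" for i
      using int that mean by (simp_all add: prob_space)
    show "integrable M (\<lambda>\<omega>. (?Z i \<omega>)\<^sup>2)" if "i \<in> I" for i
      using int that by (simp add: power2_diff)
  qed (use I in auto)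
  moreover have "expectation (\<lambda>\<omega>. (?Z i \<omega>)\<^sup>2) = v" if "i \<in> I" for i
    using var[OF that] mean[OF that] by simp
  ultimately have "expectation (\<lambda>\<omega>. (1 / ?n * (\<Sum>i\<in>I. ?Z i \<omega>))\<^sup>2) = v / ?n"
    using n by (simp add: power_divide power2_eq_square)
  then show ?thesis
    unfolding eq
    using L1_le_sqrt_second_moment[of "\<lambda>\<omega>. 1 / ?n * (\<Sum>i\<in>I. ?Z i \<omega>)"] sm int
    by (simp add: power_divide)
qed

text \<open>The minimum is attained at some \<open>g\<close>, and the deviation of that
  \<open>f g\<close> is one of the nonnegative summands.\<close>

lemma abs_Min_minus_le_sum:
  fixes f :: "'i \<Rightarrow> real"
  assumes "finite S" "S \<noteq> {}"
  shows "\<bar>(MIN g\<in>S. f g) - c\<bar> \<le> (\<Sum>g\<in>S. \<bar>f g - c\<bar>)"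
proof -
  have "(MIN g\<in>S. f g) \<in> f ` S"
    by (rule Min_in) (use assms in simp_all)
  then obtain g where "g \<in> S" "(MIN g\<in>S. f g) = f g"
    by blast
  then show ?thesis
    using member_le_sum[of g S "\<lambda>g. \<bar>f g - c\<bar>"] assms by simp
qed

lemma (in prob_space) integrable_MIN:
  fixes f :: "'i \<Rightarrow> 'a \<Rightarrow> real"
  assumes "finite S" "S \<noteq> {}" "\<And>g. g \<in> S \<Longrightarrow> integrable M (f g)"
  shows "integrable M (\<lambda>\<omega>. MIN g\<in>S. f g \<omega>)"
  using assms
proof (induction rule: finite_ne_induct)
  case (insert g S)
  then have "integrable M (\<lambda>\<omega>. min (f g \<omega>) (MIN g\<in>S. f g \<omega>))"
    by (intro integrable_min) auto
  with insert show ?case by simp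
qed simp

section \<open>The two average rates\<close>

lemma expectation_ln_power_exponential:
  assumes "prob_space M" "0 < l" "distributed M lborel X (exponential_density l)"
  shows "integrable M (\<lambda>\<omega>. ln (1 + X \<omega>) ^ i)"
    and "(\<integral>\<omega>. ln (1 + X \<omega>) ^ i \<partial>M) = (\<integral>x. exponential_density l x * ln (1 + x) ^ i \<partial>lborel)"
proof -
  show "integrable M (\<lambda>\<omega>. ln (1 + X \<omega>) ^ i)"
    using distributed_integrable[OF assms(3), of "\<lambda>x. ln (1 + x) ^ i"]
      integrable_exponential_density_ln_power[OF assms(2), of i] assms(2) by simp
  show "(\<integral>\<omega>. ln (1 + X \<omega>) ^ i \<partial>M) = (\<integral>x. exponential_density l x * ln (1 + x) ^ i \<partial>lborel)"
    using distributed_integral[OF assms(3), of "\<lambda>x. ln (1 + x) ^ i"] assms(2) by simp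
qed

lemma expectation_ln_exponential:
  assumes "prob_space M" "0 < l" "distributed M lborel X (exponential_density l)"
  shows "(\<integral>\<omega>. ln (1 + X \<omega>) \<partial>M) = - exp l * Ei (- l)"
  using expectation_ln_power_exponential(2)[OF assms, of 1] integral_exponential_density_ln[OF assms(2)]
  by simp

text \<open>The minimum of independent exponential variables is exponential with the sum of their
  rates, here \<open>card U / \<rho>\<close>. The value depends on \<open>U\<close> only through its
  cardinality, hence not on \<open>B\<close>.\<close>

lemma rate_MN_eq:
  assumes iid: "iid_exponential M \<rho> I X" and \<rho>: "0 < \<rho>" and U: "U \<subseteq> I" "0 < card U"
  shows "rate_MN M U X = card U / ln 2 * (- exp (card U / \<rho>) * Ei (- (card U / \<rho>)))"
proof -
  interpret prob_space M using iid by (simp add: iid_exponential_def)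
  have fin: "finite U" "U \<noteq> {}" using U(2) by (auto simp: card_gt_0_iff)
  have "distributed M lborel (\<lambda>\<omega>. MIN k\<in>U. X k \<omega>) (exponential_density (\<Sum>k\<in>U. 1 / \<rho>))"
    using iid U \<rho> fin indep_vars_subset[of "\<lambda>_. borel" X I U]
    by (intro exponential_distributed_Min) (auto simp: iid_exponential_def)
  then have D: "distributed M lborel (\<lambda>\<omega>. MIN k\<in>U. X k \<omega>) (exponential_density (card U / \<rho>))"
    by simp
  show ?thesis
    using expectation_ln_exponential[OF prob_space_axioms _ D] U \<rho> by (simp add: rate_MN_def)
qed

text \<open>Here \<open>m\<close> and \<open>v\<close> are the first and second moments of
  \<open>ln (1 + X k)\<close>, so \<open>v - m\<^sup>2\<close> is its variance. The inner factor
  \<open>card S\<close> comes from bounding the error of the minimum by the sum over the groups. The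
  right-hand side does not involve \<open>M\<close> or \<open>X\<close>.\<close>

lemma rate_ACC_bound:
  assumes iid: "iid_exponential M \<rho> (users \<Lambda> B) X" and \<rho>: "0 < \<rho>" and B: "1 \<le> B"
    and S: "S \<subseteq> {1..\<Lambda>}" "0 < card S"
  defines "m \<equiv> - exp (1 / \<rho>) * Ei (- (1 / \<rho>))"
    and "v \<equiv> (\<integral>x. exponential_density (1 / \<rho>) x * ln (1 + x) ^ 2 \<partial>lborel)"
  shows "\<bar>rate_ACC M B S X - card S / ln 2 * m\<bar> \<le> card S / ln 2 * (card S * sqrt ((v - m\<^sup>2) / B))"
proof -
  interpret prob_space M using iid by (simp add: iid_exponential_def)
  have ind: "indep_vars (\<lambda>_. borel) X (users \<Lambda> B)"
    and dist: "\<And>k. k \<in> users \<Lambda> B \<Longrightarrow> distributed M lborel (X k) (exponential_density (1 / \<rho>))"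
    using iid by (auto simp: iid_exponential_def)
  have \<rho>': "0 < 1 / \<rho>" using \<rho> by simp
  have fin: "finite S" "S \<noteq> {}" using S(2) by (auto simp: card_gt_0_iff)
  let ?Y = "\<lambda>k \<omega>. ln (1 + X k \<omega>)"
  let ?A = "\<lambda>g \<omega>. 1 / real B * (\<Sum>b = 1..B. ?Y (g, b) \<omega>)"
  have int: "integrable M (?Y k)" "integrable M (\<lambda>\<omega>. (?Y k \<omega>)\<^sup>2)" "expectation (?Y k) = m"
    "variance (?Y k) = v - m\<^sup>2" if "k \<in> users \<Lambda> B" for k
  proof -
    note L = expectation_ln_power_exponential[OF prob_space_axioms \<rho>' dist[OF that]]
    show i: "integrable M (?Y k)" "integrable M (\<lambda>\<omega>. (?Y k \<omega>)\<^sup>2)"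
      using L(1)[of 1] L(1)[of 2] by simp_all
    show e: "expectation (?Y k) = m"
      using expectation_ln_exponential[OF prob_space_axioms \<rho>' dist[OF that]] by (simp add: m_def)
    show "variance (?Y k) = v - m\<^sup>2"
      using variance_eq[OF i] L(2)[of 2] e by (simp add: v_def)
  qed
  have indY: "indep_vars (\<lambda>_. borel) ?Y (users \<Lambda> B)"
    using indep_vars_compose2[OF ind, of "\<lambda>_ x. ln (1 + x)"] by auto
  \<comment> \<open>The users of group \<open>g\<close> are indexed by the image of
    \<open>{1..B}\<close> under \<open>Pair g\<close>; as this map is injective, the average over
    \<open>b\<close> becomes one over that image.\<close>
  have sub: "Pair g ` {1..B} \<subseteq> users \<Lambda> B" if "g \<in> S" for g
    using that S by (auto simp: users_def)
  have avg: "expectation (\<lambda>\<omega>. \<bar>?A g \<omega> - m\<bar>) \<le> sqrt ((v - m\<^sup>2) / B)" if "g \<in> S" for g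
  proof -
    have inj: "inj_on (Pair g) {1..B}" by (auto intro: inj_onI)
    have "expectation (\<lambda>\<omega>. \<bar>1 / real (card (Pair g ` {1..B})) * (\<Sum>k\<in>Pair g ` {1..B}. ?Y k \<omega>) - m\<bar>)
        \<le> sqrt ((v - m\<^sup>2) / real (card (Pair g ` {1..B})))"
      using B int sub[OF that] indep_vars_subset[OF indY sub[OF that]]
      by (intro L1_distance_average_indep) (auto simp: subset_iff)
    then show ?thesis
      unfolding card_image[OF inj] sum.reindex[OF inj] by (simp add: comp_def)
  qed
  have intA: "integrable M (?A g)" if "g \<in> S" for g
    using sub[OF that] by (intro integrable_mult_right Bochner_Integration.integrable_sum int(1)) auto
  have intMin: "integrable M (\<lambda>\<omega>. MIN g\<in>S. ?A g \<omega>)"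
    using fin intA by (rule integrable_MIN)
  have intabs: "integrable M (\<lambda>\<omega>. \<bar>?A g \<omega> - m\<bar>)" if "g \<in> S" for g
    using intA[OF that] by (intro integrable_abs Bochner_Integration.integrable_diff) auto
  have "\<bar>expectation (\<lambda>\<omega>. MIN g\<in>S. ?A g \<omega>) - m\<bar> = \<bar>expectation (\<lambda>\<omega>. (MIN g\<in>S. ?A g \<omega>) - m)\<bar>"
    using Bochner_Integration.integral_diff[OF intMin, of "\<lambda>_. m"] by (simp add: prob_space)
  also have "\<dots> \<le> expectation (\<lambda>\<omega>. \<bar>(MIN g\<in>S. ?A g \<omega>) - m\<bar>)"
    by (rule integral_abs_bound)
  also have "\<dots> \<le> expectation (\<lambda>\<omega>. \<Sum>g\<in>S. \<bar>?A g \<omega> - m\<bar>)"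
  proof (rule integral_mono)
    show "integrable M (\<lambda>\<omega>. \<bar>(MIN g\<in>S. ?A g \<omega>) - m\<bar>)"
      by (rule integrable_abs[OF Bochner_Integration.integrable_diff[OF intMin integrable_const]])
    show "integrable M (\<lambda>\<omega>. \<Sum>g\<in>S. \<bar>?A g \<omega> - m\<bar>)"
      using intabs by (rule Bochner_Integration.integrable_sum)
    show "\<bar>(MIN g\<in>S. ?A g \<omega>) - m\<bar> \<le> (\<Sum>g\<in>S. \<bar>?A g \<omega> - m\<bar>)" for \<omega>
      using fin by (rule abs_Min_minus_le_sum)
  qed
  also have "\<dots> = (\<Sum>g\<in>S. expectation (\<lambda>\<omega>. \<bar>?A g \<omega> - m\<bar>))"
    using intabs by (rule Bochner_Integration.integral_sum)
  also have "\<dots> \<le> card S * sqrt ((v - m\<^sup>2) / B)"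
    using sum_bounded_above[OF avg] by simp
  finally have "\<bar>expectation (\<lambda>\<omega>. MIN g\<in>S. ?A g \<omega>) - m\<bar> \<le> card S * sqrt ((v - m\<^sup>2) / B)" .
  then have bound: "card S / ln 2 * \<bar>expectation (\<lambda>\<omega>. MIN g\<in>S. ?A g \<omega>) - m\<bar>
      \<le> card S / ln 2 * (card S * sqrt ((v - m\<^sup>2) / B))"
    by (rule mult_left_mono) simp
  have eq: "rate_ACC M B S X - card S / ln 2 * m
      = card S / ln 2 * (expectation (\<lambda>\<omega>. MIN g\<in>S. ?A g \<omega>) - m)"
    unfolding rate_ACC_def right_diff_distrib ..
  have "\<bar>card S / ln 2\<bar> = card S / ln 2"
    by simp
  with bound show ?thesis
    unfolding eq abs_mult by (simp only:)
qed

lemma rate_ACC_tendsto: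
  assumes iid: "\<And>B. 1 \<le> B \<Longrightarrow> iid_exponential (M B) \<rho> (users \<Lambda> B) (X B)" and \<rho>: "0 < \<rho>"
    and S: "S \<subseteq> {1..\<Lambda>}" "0 < card S"
  shows "(\<lambda>B. rate_ACC (M B) B S (X B)) \<longlonglongrightarrow> card S / ln 2 * (- exp (1 / \<rho>) * Ei (- (1 / \<rho>)))"
proof -
  define m where "m = - exp (1 / \<rho>) * Ei (- (1 / \<rho>))"
  define v where "v = (\<integral>x. exponential_density (1 / \<rho>) x * ln (1 + x) ^ 2 \<partial>lborel)"
  have "(\<lambda>B. rate_ACC (M B) B S (X B) - card S / ln 2 * m) \<longlonglongrightarrow> 0"
  proof (rule Lim_null_comparison)
    show "\<forall>\<^sub>F B in sequentially. norm (rate_ACC (M B) B S (X B) - card S / ln 2 * m)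
        \<le> card S / ln 2 * (card S * sqrt ((v - m\<^sup>2) / real B))"
      \<comment> \<open>Nothing is assumed at \<open>B = 0\<close>, so the comparison starts at
        1.\<close>
      using eventually_ge_at_top[of 1]
      by eventually_elim (use rate_ACC_bound[OF iid \<rho> _ S] in \<open>simp add: m_def v_def\<close>)
    have "(\<lambda>B. card S / ln 2 * (card S * sqrt ((v - m\<^sup>2) / real B))) \<longlonglongrightarrow> card S / ln 2 * (card S * sqrt 0)"
      by (intro tendsto_intros lim_const_over_n)
    then show "(\<lambda>B. card S / ln 2 * (card S * sqrt ((v - m\<^sup>2) / real B))) \<longlonglongrightarrow> 0"
      by simp
  qed
  then show ?thesis
    unfolding m_def by (rule LIM_zero_cancel)
qed

section \<open>The limit of vanishing SNR and the conclusion\<close>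

text \<open>With \<open>?f l\<close> tending to 1 at infinity, the expression is \<open>c\<close>
  times the quotient of \<open>?f\<close> at \<open>1 / \<rho>\<close> and at
  \<open>c / \<rho>\<close>; the factor \<open>c\<close> offsets the quotient of the two
  arguments.\<close>

lemma tendsto_Ei_ratio:
  assumes "0 < c"
  shows "((\<lambda>\<rho>. exp ((1 - c) / \<rho>) * (Ei (- (1 / \<rho>)) / Ei (- (c / \<rho>)))) \<longlongrightarrow> c) (at_right 0)"
proof -
  let ?f = "\<lambda>l. l * (- exp l * Ei (- l))"
  have "filterlim (\<lambda>\<rho>. 1 / \<rho>) at_top (at_right (0::real))" "filterlim (\<lambda>\<rho>. c / \<rho>) at_top (at_right (0::real))"
    using assms by real_asymp+
  then have "((\<lambda>\<rho>. c * (?f (1 / \<rho>) / ?f (c / \<rho>))) \<longlongrightarrow> c * (1 / 1)) (at_right 0)"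
    by (intro tendsto_intros filterlim_compose[OF tendsto_neg_exp_Ei]) auto
  moreover have "\<forall>\<^sub>F \<rho> in at_right 0. c * (?f (1 / \<rho>) / ?f (c / \<rho>)) =
      exp ((1 - c) / \<rho>) * (Ei (- (1 / \<rho>)) / Ei (- (c / \<rho>)))"
    using eventually_at_right_less[of 0]
    by eventually_elim (use assms in \<open>simp add: diff_divide_distrib exp_diff\<close>)
  ultimately show ?thesis
    by (simp add: tendsto_cong)
qed

text \<open>The probability space and the SNRs may vary with \<open>\<rho>\<close> and
  \<open>B\<close>, and the users served by MN with \<open>B\<close>. The value \<open>lim\<close>
  in the second part is a genuine limit for every positive \<open>\<rho>\<close> by the first
  part.\<close>

theorem lemma5:
  fixes \<Lambda> :: nat and \<gamma> :: real and \<G> :: "nat set" and G :: nat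
    and M :: "real \<Rightarrow> nat \<Rightarrow> 'a measure"
    and SNR :: "real \<Rightarrow> nat \<Rightarrow> nat \<times> nat \<Rightarrow> 'a \<Rightarrow> real"
    and U :: "nat \<Rightarrow> (nat \<times> nat) set"
  assumes "0 \<le> \<gamma>" and "\<gamma> \<le> 1"
    and "real \<Lambda> * \<gamma> \<in> \<int>" and "real \<Lambda> * \<gamma> + 1 \<le> real \<Lambda>"
    and "\<G> \<subseteq> {1..\<Lambda>}" and "G = card \<G>" and "real G = real \<Lambda> * \<gamma> + 1"
    and "\<And>B. B \<ge> 1 \<Longrightarrow> U B \<subseteq> users \<Lambda> B \<and> card (U B) = G"
    and "\<And>\<rho> B. \<rho> > 0 \<Longrightarrow> B \<ge> 1 \<Longrightarrow> iid_exponential (M \<rho> B) \<rho> (users \<Lambda> B) (SNR \<rho> B)"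
  shows "(\<forall>\<rho>>0. (\<lambda>B. rate_ACC (M \<rho> B) B \<G> (SNR \<rho> B) / rate_MN (M \<rho> B) (U B) (SNR \<rho> B))
            \<longlonglongrightarrow> exp ((1 - real G) / \<rho>) * (Ei (- (1 / \<rho>)) / Ei (- (real G / \<rho>)))) \<and>
         ((\<lambda>\<rho>. lim (\<lambda>B. rate_ACC (M \<rho> B) B \<G> (SNR \<rho> B) / rate_MN (M \<rho> B) (U B) (SNR \<rho> B)))
            \<longlongrightarrow> real \<Lambda> * \<gamma> + 1) (at_right 0)"
proof -
  have "0 < real G"
    using \<open>real G = real \<Lambda> * \<gamma> + 1\<close> \<open>0 \<le> \<gamma>\<close> by (simp add: add_nonneg_pos)
  then have G: "0 < G" by simp
  let ?L = "\<lambda>\<rho>. exp ((1 - real G) / \<rho>) * (Ei (- (1 / \<rho>)) / Ei (- (real G / \<rho>)))"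
  let ?q = "\<lambda>\<rho> B. rate_ACC (M \<rho> B) B \<G> (SNR \<rho> B) / rate_MN (M \<rho> B) (U B) (SNR \<rho> B)"
  have lim1: "?q \<rho> \<longlonglongrightarrow> ?L \<rho>" if \<rho>: "0 < \<rho>" for \<rho>
  proof -
    \<comment> \<open>This is the MN rate for every \<open>B \<ge> 1\<close>, so the quotient has an
      eventually constant denominator.\<close>
    let ?c = "real G / ln 2 * (- exp (G / \<rho>) * Ei (- (G / \<rho>)))"
    have "0 < 1 / (G / \<rho> + 1)"
      using G \<rho> by (intro divide_pos_pos add_nonneg_pos) auto
    with neg_exp_Ei_bounds(1)[of "G / \<rho>"] G \<rho> have Ei: "Ei (- (G / \<rho>)) \<noteq> 0"
      by auto
    have "(\<lambda>B. rate_ACC (M \<rho> B) B \<G> (SNR \<rho> B)) \<longlonglongrightarrow> real G / ln 2 * (- exp (1 / \<rho>) * Ei (- (1 / \<rho>)))"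
      using rate_ACC_tendsto[of "M \<rho>" \<rho> \<Lambda> "SNR \<rho>" \<G>] assms(5,6,9) G \<rho> by auto
    then have "(\<lambda>B. rate_ACC (M \<rho> B) B \<G> (SNR \<rho> B) / ?c) \<longlonglongrightarrow>
        real G / ln 2 * (- exp (1 / \<rho>) * Ei (- (1 / \<rho>))) / ?c"
      using Ei G by (intro tendsto_divide tendsto_const) auto
    also have "real G / ln 2 * (- exp (1 / \<rho>) * Ei (- (1 / \<rho>))) / ?c = ?L \<rho>"
      using Ei G by (simp add: diff_divide_distrib exp_diff)
    finally show ?thesis
    proof (rule Lim_transform_eventually)
      show "\<forall>\<^sub>F B in sequentially. rate_ACC (M \<rho> B) B \<G> (SNR \<rho> B) / ?c = ?q \<rho> B"
        using eventually_ge_at_top[of 1]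
      proof eventually_elim
        case (elim B)
        show ?case
          using rate_MN_eq[OF assms(9)[OF \<rho> elim] \<rho>, of "U B"] assms(8)[OF elim] G by simp
      qed
    qed
  qed
  \<comment> \<open>The filter \<open>at_right 0\<close> sees only positive \<open>\<rho>\<close>
    near 0, where \<open>lim1\<close> identifies the inner limit.\<close>
  have "\<forall>\<^sub>F \<rho> in at_right 0. ?L \<rho> = lim (?q \<rho>)"
    using eventually_at_right_less[of 0] by eventually_elim (rule limI[OF lim1, symmetric])
  then have "((\<lambda>\<rho>. lim (?q \<rho>)) \<longlongrightarrow> real G) (at_right 0)"
    by (rule Lim_transform_eventually[OF tendsto_Ei_ratio[OF \<open>0 < real G\<close>]])
  with lim1 \<open>real G = real \<Lambda> * \<gamma> + 1\<close> show ?thesis by simp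
qed

end
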